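(* Let $X$ be a Banach space with weak*-convex block compact dual ball, and let $\gamma_1,\gamma_2\le\omega_1$ be ordinals. Let $Y\subset X$ be a closed linear subspace with property $\mathcal{E}(\gamma_1)$ such that $X/Y$ has property $\mathcal{E}(\gamma_2)$. Then $X$ has property $\mathcal{E}(\gamma_1+\gamma_2)$.
   Context: For a subset $F$ of a Hausdorff topological space $T$, the sequential closure of $F$ is the set of all limits (in $T$) of convergent sequences of elements of $F$. Define $S_\alpha(F)$ by transfinite induction: $S_0(F)=F$, $S_{\alpha+1}(F)$ is the sequential closure of $S_\alpha(F)$, and $S_\alpha(F)=\bigcup_{\beta<\alpha}S_\beta(F)$ for $\alpha$ a limit ordinal (so $S_\alpha(F)=S_{\omega_1}(F)$ for all $\alpha\ge\omega_1$). A Banach space $X$ has property $\mathcal{E}(\alpha)$ if $S_\alpha(C)=\overline{C}^{w^*}$ for every convex subset $C$ of the closed dual unit ball $B_{X^*}$, where $S_\alpha$ and the closure are taken in $B_{X^*}$ with the weak* topology. If $(x_n)_{n<\omega}$ is a sequence in a Banach space, $(y_k)_{k<\omega}$ is a convex block subsequence of $(x_n)_{n<\omega}$ if there are a sequence $(I_k)_{k<\omega}$ of (nonempty finite) subsets of $\omega$ with $\max(I_k)<\min(I_{k+1})$ and a sequence $a_n\in[0,1]$ with $\sum_{n\in I_k}a_n=1$ for every $k<\omega$ such that $y_k=\sum_{n\in I_k}a_nx_n$. A Banach space $X$ has weak*-convex block compact dual ball if every bounded sequence in $X^*$ has a weak*-convergent convex block subsequence. *)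

theory Defs
  imports "HOL-Analysis.Analysis" "HOL-Library.Set_Algebras"
begin

section \<open>Ordinals and iterated sequential closures\<close>

text \<open>
  An ordinal is represented by a well-order relation \<open>r\<close> on an arbitrary type; the ordinals
  smaller than \<open>r\<close> are the proper initial segments \<open>Restr r (underS r x)\<close> with
  \<open>x \<in> Field r\<close>.  Thus \<open>r\<close> is a successor iff it has a greatest element \<open>m\<close>, and its predecessor
  is then \<open>Restr r (underS r m)\<close>.
\<close>

abbreviation omega1 :: "nat set rel" where
  "omega1 \<equiv> cardSuc natLeq"

definition ord_sum :: "'a rel \<Rightarrow> 'b rel \<Rightarrow> ('a + 'b) rel" where
  "ord_sum r s =
     {(Inl x, Inl y) | x y. (x, y) \<in> r} \<union> {(Inr x, Inr y) | x y. (x, y) \<in> s}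
     \<union> {(Inl x, Inr y) | x y. x \<in> Field r \<and> y \<in> Field s}"

definition greatest_elem :: "'a rel \<Rightarrow> 'a \<Rightarrow> bool" where
  "greatest_elem r m \<longleftrightarrow> m \<in> Field r \<and> (\<forall>x\<in>Field r. (x, m) \<in> r)"

definition seq_closure :: "'a topology \<Rightarrow> 'a set \<Rightarrow> 'a set" where
  "seq_closure T F = {l. \<exists>s. (\<forall>n. s n \<in> F) \<and> limitin T s l sequentially}"

lemma the_greatest_elem:
  assumes "Well_order r" "greatest_elem r m"
  shows "(THE x. greatest_elem r x) = m"
proof (rule the_equality)
  have "antisym r"
    using assms(1) by (simp add: order_on_defs)
  then show "x = m" if "greatest_elem r x" for x
    using that assms(2) by (auto simp: greatest_elem_def antisym_def)
qed (rule assms)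

text \<open>The value on relations that are not well-orders is irrelevant.\<close>

function S_iter :: "'a topology \<Rightarrow> 'a set \<Rightarrow> 'b rel \<Rightarrow> 'a set" where
  "S_iter T F r =
     (if \<not> Well_order r \<or> Field r = {} then F
      else if \<exists>m. greatest_elem r m
      then seq_closure T (S_iter T F (Restr r (underS r (THE m. greatest_elem r m))))
      else (\<Union>x\<in>Field r. S_iter T F (Restr r (underS r x))))"
  by pat_completeness auto
termination
proof (relation "inv_image ordLess (\<lambda>(T, F, r). r)")
  show "wf (inv_image ordLess (\<lambda>(T :: 'a topology, F :: 'a set, r :: 'b rel). r))"
    by (rule wf_inv_image) (rule wf_ordLess)
next
  fix T :: "'a topology" and F :: "'a set" and r :: "'b rel"
  assume "\<not> (\<not> Well_order r \<or> Field r = {})" and "\<exists>m. greatest_elem r m"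
  then obtain m where "Well_order r" "greatest_elem r m"
    by blast
  then show "((T, F, Restr r (underS r (THE m. greatest_elem r m))), T, F, r)
      \<in> inv_image ordLess (\<lambda>(T, F, r). r)"
    using underS_Restr_ordLess[of r] by (auto simp: the_greatest_elem greatest_elem_def)
next
  fix T :: "'a topology" and F :: "'a set" and r :: "'b rel" and x
  assume "\<not> (\<not> Well_order r \<or> Field r = {})"
  then show "((T, F, Restr r (underS r x)), T, F, r) \<in> inv_image ordLess (\<lambda>(T, F, r). r)"
    using underS_Restr_ordLess[of r] by auto
qed

declare S_iter.simps [simp del]

lemma S_iter_zero: "S_iter T F {} = F"
  by (simp add: S_iter.simps[of T F "{}"])

lemma S_iter_succ:
  assumes "Well_order r" "greatest_elem r m"
  shows "S_iter T F r = seq_closure T (S_iter T F (Restr r (underS r m)))"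
proof -
  have "Field r \<noteq> {}" "\<exists>m. greatest_elem r m"
    using assms by (auto simp: greatest_elem_def)
  then show ?thesis
    using assms by (simp add: S_iter.simps[of T F r] the_greatest_elem)
qed

lemma S_iter_limit:
  assumes "Well_order r" "Field r \<noteq> {}" "\<nexists>m. greatest_elem r m"
  shows "S_iter T F r = (\<Union>x\<in>Field r. S_iter T F (Restr r (underS r x)))"
  using assms by (subst S_iter.simps) (simp only: not_True_eq_False simp_thms if_False)

lemma Field_ord_sum: "Field (ord_sum r s) = Inl ` Field r \<union> Inr ` Field s"
proof (intro set_eqI iffI)
  fix x assume "x \<in> Field (ord_sum r s)"
  then obtain y where "(x, y) \<in> ord_sum r s \<or> (y, x) \<in> ord_sum r s"
    by (auto simp: Field_def)
  then show "x \<in> Inl ` Field r \<union> Inr ` Field s"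
    by (auto simp: ord_sum_def intro: FieldI1 FieldI2)
next
  have "Inl a \<in> Field (ord_sum r s)" if ab: "(a, b) \<in> r \<or> (b, a) \<in> r" for a b
  proof -
    have "(Inl a, Inl b) \<in> ord_sum r s \<or> (Inl b, Inl a) \<in> ord_sum r s"
      using ab by (auto simp: ord_sum_def)
    then show ?thesis by (auto intro: FieldI1 FieldI2)
  qed
  moreover have "Inr a \<in> Field (ord_sum r s)" if ab: "(a, b) \<in> s \<or> (b, a) \<in> s" for a b
  proof -
    have "(Inr a, Inr b) \<in> ord_sum r s \<or> (Inr b, Inr a) \<in> ord_sum r s"
      using ab by (auto simp: ord_sum_def)
    then show ?thesis by (auto intro: FieldI1 FieldI2)
  qed
  moreover fix x assume "x \<in> Inl ` Field r \<union> Inr ` Field s"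
  ultimately show "x \<in> Field (ord_sum r s)"
    by (auto simp: Field_def[of r] Field_def[of s])
qed

lemma Well_order_ord_sum:
  assumes r: "Well_order r" and s: "Well_order s"
  shows "Well_order (ord_sum r s)"
proof -
  let ?t = "ord_sum r s"
  have tr: "refl_on (Field r) r" "trans r" "antisym r" "total_on (Field r) r" "wf (r - Id)"
    and ts: "refl_on (Field s) s" "trans s" "antisym s" "total_on (Field s) s" "wf (s - Id)"
    using r s by (auto simp: order_on_defs)
  have "?t \<subseteq> Field ?t \<times> Field ?t"
    by (auto simp: Field_def)
  moreover have "refl_on (Field ?t) ?t"
    using tr(1) ts(1) unfolding refl_on_def Field_ord_sum by (auto simp: ord_sum_def)
  moreover have "trans ?t"
  proof (rule transI)
    fix x y z assume "(x, y) \<in> ?t" "(y, z) \<in> ?t"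
    then show "(x, z) \<in> ?t"
      using tr(2) ts(2) by (auto simp: ord_sum_def intro: FieldI1 FieldI2 dest: transD)
  qed
  moreover have "antisym ?t"
    using tr(3) ts(3) by (auto simp: antisym_def ord_sum_def)
  moreover have "total_on (Field ?t) ?t"
    using tr(4) ts(4) unfolding total_on_def Field_ord_sum
    by (simp add: ord_sum_def image_iff ball_Un)
  moreover have "wf (?t - Id)"
  proof (rule wfI_min)
    fix x and Q :: "('a + 'b) set" assume x: "x \<in> Q"
    show "\<exists>z\<in>Q. \<forall>y. (y, z) \<in> ?t - Id \<longrightarrow> y \<notin> Q"
    proof (cases "\<exists>a. Inl a \<in> Q")
      case True
      then obtain a where "Inl a \<in> Q" "\<forall>b. (b, a) \<in> r - Id \<longrightarrow> Inl b \<notin> Q"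
        using wfE_min[OF tr(5), of _ "{a. Inl a \<in> Q}"] by (metis mem_Collect_eq)
      then show ?thesis
        by (intro bexI[of _ "Inl a"]) (auto simp: ord_sum_def)
    next
      case False
      with x obtain c where "Inr c \<in> Q"
        by (cases x) auto
      then obtain a where "Inr a \<in> Q" "\<forall>b. (b, a) \<in> s - Id \<longrightarrow> Inr b \<notin> Q"
        using wfE_min[OF ts(5), of _ "{a. Inr a \<in> Q}"] by (metis mem_Collect_eq)
      with False show ?thesis
        by (intro bexI[of _ "Inr a"]) (auto simp: ord_sum_def)
    qed
  qed
  ultimately show ?thesis
    by (simp add: order_on_defs)
qed


section \<open>Real normed spaces with a carrier, subspaces and quotients\<close>

text \<open>
  A closed subspace \<open>Y\<close> of a Banach space and the quotient by it depend on the set \<open>Y\<close>, so they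
  are not types; a normed space is therefore given by its carrier set, its operations and its norm.
\<close>

record 'v nspace =
  carrier :: "'v set"
  vadd :: "'v \<Rightarrow> 'v \<Rightarrow> 'v"
  vscale :: "real \<Rightarrow> 'v \<Rightarrow> 'v"
  vnorm :: "'v \<Rightarrow> real"

definition subspace_of :: "'a::real_normed_vector set \<Rightarrow> 'a nspace" where
  "subspace_of Y = \<lparr>carrier = Y, vadd = (+), vscale = (*\<^sub>R), vnorm = norm\<rparr>"

abbreviation whole_space :: "'a::real_normed_vector nspace" where
  "whole_space \<equiv> subspace_of UNIV"

text \<open>
  The elements of the quotient are the cosets \<open>x +o Y\<close>.  Adding \<open>Y\<close> in the scalar
  multiplication matters only for the scalar \<open>0\<close>, where \<open>0 \<cdot> A\<close> has to be \<open>Y\<close>.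
\<close>

definition quotient_by :: "'a::real_normed_vector set \<Rightarrow> 'a set nspace" where
  "quotient_by Y =
     \<lparr>carrier = range (\<lambda>x. x +o Y), vadd = (+), vscale = (\<lambda>c A. (*\<^sub>R) c ` A + Y),
      vnorm = (\<lambda>A. INF x\<in>A. norm x)\<rparr>"

lemma quotient_by_operations:
  assumes "subspace Y"
  shows "vadd (quotient_by Y) (x +o Y) (y +o Y) = (x + y) +o Y"
    and "vscale (quotient_by Y) c (x +o Y) = (c *\<^sub>R x) +o Y"
    and "vnorm (quotient_by Y) (x +o Y) = infdist x Y"
    and "x +o Y = y +o Y \<longleftrightarrow> x - y \<in> Y"
proof -
  have 0: "0 \<in> Y" and add: "\<And>u v. u \<in> Y \<Longrightarrow> v \<in> Y \<Longrightarrow> u + v \<in> Y"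
    and sc: "\<And>c u. u \<in> Y \<Longrightarrow> c *\<^sub>R u \<in> Y"
    using assms by (auto simp: subspace_def)
  have neg: "- u \<in> Y" if "u \<in> Y" for u
    using sc[OF that, of "-1"] by simp
  have YY: "Y + Y = Y"
  proof
    show "Y + Y \<subseteq> Y"
      using add by (auto simp: set_plus_def)
    show "Y \<subseteq> Y + Y"
      using 0 set_zero_plus2 by blast
  qed
  show "vadd (quotient_by Y) (x +o Y) (y +o Y) = (x + y) +o Y"
    by (simp add: quotient_by_def set_plus_rearrange YY)
  have "(*\<^sub>R) c ` (x +o Y) + Y = (c *\<^sub>R x) +o Y"
  proof
    show "(*\<^sub>R) c ` (x +o Y) + Y \<subseteq> (c *\<^sub>R x) +o Y"
      using add sc by (auto simp: set_plus_def elt_set_plus_def scaleR_add_right add.assoc)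
    show "(c *\<^sub>R x) +o Y \<subseteq> (*\<^sub>R) c ` (x +o Y) + Y"
    proof
      fix z assume "z \<in> (c *\<^sub>R x) +o Y"
      then obtain y where "y \<in> Y" "z = c *\<^sub>R x + y"
        by (auto simp: elt_set_plus_def)
      moreover have "x \<in> x +o Y"
        using 0 by (auto simp: elt_set_plus_def)
      ultimately show "z \<in> (*\<^sub>R) c ` (x +o Y) + Y"
        by (auto simp: set_plus_def)
    qed
  qed
  then show "vscale (quotient_by Y) c (x +o Y) = (c *\<^sub>R x) +o Y"
    by (simp add: quotient_by_def)
  have "norm ` (x +o Y) = dist x ` Y"
  proof (intro equalityI subsetI)
    fix t assume "t \<in> norm ` (x +o Y)"
    then obtain y where "y \<in> Y" "t = norm (x + y)"
      by (auto simp: elt_set_plus_def)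
    then show "t \<in> dist x ` Y"
      using neg by (auto simp: dist_norm intro!: image_eqI[of _ _ "- y"])
  next
    fix t assume "t \<in> dist x ` Y"
    then obtain y where "y \<in> Y" "t = norm (x - y)"
      by (auto simp: dist_norm)
    then show "t \<in> norm ` (x +o Y)"
      using neg[of y] by (auto simp: elt_set_plus_def intro!: image_eqI[of _ _ "x - y"] bexI[of _ "- y"])
  qed
  then show "vnorm (quotient_by Y) (x +o Y) = infdist x Y"
    using 0 by (auto simp: quotient_by_def infdist_def)
  show "x +o Y = y +o Y \<longleftrightarrow> x - y \<in> Y"
  proof
    assume "x +o Y = y +o Y"
    moreover have "x \<in> x +o Y"
      using 0 by (auto simp: elt_set_plus_def)
    ultimately show "x - y \<in> Y"
      by (auto simp: elt_set_plus_def)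
  next
    assume *: "x - y \<in> Y"
    have "(x - y) +o Y = Y"
    proof
      show "(x - y) +o Y \<subseteq> Y"
        using * add by (auto simp: elt_set_plus_def)
      show "Y \<subseteq> (x - y) +o Y"
      proof
        fix z assume "z \<in> Y"
        then have "z + - (x - y) \<in> Y"
          using * add neg by blast
        moreover have "z = (x - y) + (z + - (x - y))"
          by simp
        ultimately show "z \<in> (x - y) +o Y"
          unfolding elt_set_plus_def by blast
      qed
    qed
    then have "y +o ((x - y) +o Y) = y +o Y"
      by simp
    then show "x +o Y = y +o Y"
      by (simp add: set_plus_rearrange2)
  qed
qed


section \<open>Dual spaces and the weak* topology\<close>

text \<open>
  Functionals are extensional functions on the carrier, so that the weak* topology, i.e. that of
  pointwise convergence, is induced by the product topology.
\<close>

definition dual :: "'v nspace \<Rightarrow> ('v \<Rightarrow> real) set" where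
  "dual V = {f \<in> extensional (carrier V).
     (\<forall>u\<in>carrier V. \<forall>v\<in>carrier V. f (vadd V u v) = f u + f v) \<and>
     (\<forall>c. \<forall>v\<in>carrier V. f (vscale V c v) = c * f v) \<and>
     (\<exists>K. \<forall>v\<in>carrier V. \<bar>f v\<bar> \<le> K * vnorm V v)}"

definition dual_norm :: "'v nspace \<Rightarrow> ('v \<Rightarrow> real) \<Rightarrow> real" where
  "dual_norm V f = (SUP v\<in>{v \<in> carrier V. vnorm V v \<le> 1}. \<bar>f v\<bar>)"

definition dual_ball :: "'v nspace \<Rightarrow> ('v \<Rightarrow> real) set" where
  "dual_ball V = {f \<in> dual V. dual_norm V f \<le> 1}"

definition weak_star :: "'v nspace \<Rightarrow> ('v \<Rightarrow> real) topology" where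
  "weak_star V = subtopology (product_topology (\<lambda>_. euclideanreal) (carrier V)) (dual V)"

definition weak_star_ball :: "'v nspace \<Rightarrow> ('v \<Rightarrow> real) topology" where
  "weak_star_ball V = subtopology (weak_star V) (dual_ball V)"

definition convex_functionals :: "'v nspace \<Rightarrow> ('v \<Rightarrow> real) set \<Rightarrow> bool" where
  "convex_functionals V C \<longleftrightarrow>
     (\<forall>f\<in>C. \<forall>g\<in>C. \<forall>t\<in>{0..1}. (\<lambda>v\<in>carrier V. (1 - t) * f v + t * g v) \<in> C)"

definition property_E :: "'v nspace \<Rightarrow> 'b rel \<Rightarrow> bool" where
  "property_E V \<alpha> \<longleftrightarrow>
     (\<forall>C. C \<subseteq> dual_ball V \<and> convex_functionals V C \<longrightarrow>
        S_iter (weak_star_ball V) C \<alpha> = weak_star_ball V closure_of C)"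

definition convex_block_subseq ::
  "'v nspace \<Rightarrow> (nat \<Rightarrow> 'v \<Rightarrow> real) \<Rightarrow> (nat \<Rightarrow> 'v \<Rightarrow> real) \<Rightarrow> bool" where
  "convex_block_subseq V x y \<longleftrightarrow>
     (\<exists>(I :: nat \<Rightarrow> nat set) (a :: nat \<Rightarrow> real).
        (\<forall>k. finite (I k) \<and> I k \<noteq> {}) \<and> (\<forall>k. Max (I k) < Min (I (Suc k))) \<and>
        (\<forall>n. a n \<in> {0..1}) \<and> (\<forall>k. (\<Sum>n\<in>I k. a n) = 1) \<and>
        (\<forall>k. y k = (\<lambda>v\<in>carrier V. \<Sum>n\<in>I k. a n * x n v)))"

definition weak_star_convex_block_compact_dual_ball :: "'v nspace \<Rightarrow> bool" where
  "weak_star_convex_block_compact_dual_ball V \<longleftrightarrow>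
     (\<forall>x. (\<forall>n. x n \<in> dual V) \<and> (\<exists>K. \<forall>n. dual_norm V (x n) \<le> K) \<longrightarrow>
        (\<exists>y l. convex_block_subseq V x y \<and> limitin (weak_star V) y l sequentially))"

text \<open>On a whole space these notions agree with the bounded linear functionals of the library.\<close>

lemma dual_whole_space:
  "dual whole_space = range (blinfun_apply :: ('a::real_normed_vector \<Rightarrow>\<^sub>L real) \<Rightarrow> 'a \<Rightarrow> real)"
proof -
  have "f \<in> dual whole_space \<longleftrightarrow> bounded_linear f" for f :: "'a \<Rightarrow> real"
  proof
    assume "f \<in> dual whole_space"
    then obtain K where "\<And>u v. f (u + v) = f u + f v" "\<And>c v. f (c *\<^sub>R v) = c * f v"
      "\<And>v. \<bar>f v\<bar> \<le> K * norm v"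
      by (auto simp: dual_def subspace_of_def)
    then show "bounded_linear f"
      by (intro bounded_linear_intro[of f K]) (auto simp: mult.commute)
  next
    assume "bounded_linear f"
    then interpret bounded_linear f .
    show "f \<in> dual whole_space"
      using add scaleR bounded
      by (auto simp: dual_def subspace_of_def extensional_def mult.commute)
  qed
  moreover have "f \<in> range blinfun_apply \<longleftrightarrow> bounded_linear f" for f :: "'a \<Rightarrow> real"
    by (metis blinfun.bounded_linear_right bounded_linear_Blinfun_apply rangeE rangeI)
  ultimately show ?thesis
    by blast
qed

lemma dual_norm_whole_space:
  "dual_norm whole_space (blinfun_apply f) = norm (f :: 'a::real_normed_vector \<Rightarrow>\<^sub>L real)"
proof -
  have le: "\<bar>f v\<bar> \<le> norm f" if "norm v \<le> 1" for v
    using norm_blinfun[of f v] mult_left_mono[OF that, of "norm f"] by simp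
  let ?B = "{v :: 'a. norm v \<le> 1}"
  let ?s = "SUP v\<in>?B. \<bar>f v\<bar>"
  have bdd: "bdd_above ((\<lambda>v. \<bar>f v\<bar>) ` ?B)"
    by (rule bdd_aboveI[of _ "norm f"]) (auto intro: le)
  have "0 \<in> ?B" by simp
  then have "?B \<noteq> {}" by blast
  then have 1: "?s \<le> norm f"
    using le by (auto intro: cSUP_least)
  have s0: "0 \<le> ?s"
    using cSUP_upper[OF \<open>0 \<in> ?B\<close> bdd] by simp
  have "norm f \<le> ?s"
  proof (rule norm_blinfun_bound[OF s0])
    fix v :: 'a
    show "norm (f v) \<le> ?s * norm v"
    proof (cases "v = 0")
      case False
      have "(1 / norm v) *\<^sub>R v \<in> ?B" using False by simp
      from cSUP_upper[OF this bdd] have "\<bar>f ((1 / norm v) *\<^sub>R v)\<bar> \<le> ?s" .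
      then show ?thesis
        using False by (simp add: blinfun.scaleR_right abs_mult field_simps)
    qed simp
  qed
  with 1 show ?thesis
    by (simp add: dual_norm_def subspace_of_def)
qed

lemma weak_star_whole_space:
  "homeomorphic_map strong_operator_topology (weak_star whole_space)
     (blinfun_apply :: ('a::real_normed_vector \<Rightarrow>\<^sub>L real) \<Rightarrow> 'a \<Rightarrow> real)"
proof -
  let ?b = "blinfun_apply :: ('a \<Rightarrow>\<^sub>L real) \<Rightarrow> 'a \<Rightarrow> real"
  have eq: "weak_star whole_space = subtopology euclidean (range ?b)"
    unfolding weak_star_def dual_whole_space
    by (simp add: subspace_of_def euclidean_product_topology)
  show ?thesis
    unfolding eq
  proof (rule bijective_open_imp_homeomorphic_map)
    show "continuous_map strong_operator_topology (subtopology euclidean (range ?b)) ?b"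
      unfolding continuous_map_in_subtopology strong_operator_topology_def
      using continuous_map_pullback[OF continuous_map_id, of UNIV ?b euclidean] by simp
    show "open_map strong_operator_topology (subtopology euclidean (range ?b)) ?b"
      unfolding open_map_def strong_operator_topology_def
      by (auto simp: openin_pullback_topology openin_subtopology)
    show "?b ` topspace strong_operator_topology = topspace (subtopology euclidean (range ?b))"
      by (simp add: strong_operator_topology_topspace)
    show "inj_on ?b (topspace strong_operator_topology)"
      by (auto simp: inj_on_def blinfun_apply_inject)
  qed
qed

end

theory Submission
  imports Defs
begin

text \<open>
  Let \<open>p\<close> be in the weak* closure of \<open>C\<close> and \<open>R\<close> the restriction of functionals to \<open>Y\<close>.  Since a
  convex block subsequence of a convergent sequence has the same limit, convex block compactness
  lifts every sequential limit of \<open>R(C)\<close> to one of \<open>C\<close>, and by induction \<open>S\<^sub>\<alpha>(R(C)) \<subseteq> R(S\<^sub>\<alpha>(C))\<close>.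
  Applied with \<open>\<alpha> = \<gamma>1\<close> to the intersections of \<open>C\<close> with convex neighbourhoods of \<open>p\<close>, this shows
  that \<open>p\<close> is in the closure of the set \<open>D\<close> of those elements of \<open>S\<^bsub>\<gamma>1\<^esub>(C)\<close> that agree with \<open>p\<close> on
  \<open>Y\<close>.  Now \<open>(D - p)/2\<close> lies in the dual ball of the quotient by \<open>Y\<close>, so that
  \<open>p \<in> S\<^bsub>\<gamma>2\<^esub>(D) \<subseteq> S\<^bsub>\<gamma>2\<^esub>(S\<^bsub>\<gamma>1\<^esub>(C)) = S\<^bsub>\<gamma>1 + \<gamma>2\<^esub>(C)\<close>.
\<close>

section \<open>Initial segments of well-orders and induction over them\<close>

abbreviation init_seg :: "'b rel \<Rightarrow> 'b \<Rightarrow> 'b rel" where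
  "init_seg r x \<equiv> Restr r (underS r x)"

lemma Field_init_seg:
  assumes "Well_order r"
  shows "Field (init_seg r x) = underS r x"
proof -
  have "Refl r" using assms by (simp add: order_on_defs)
  then show ?thesis
    by (intro Refl_Field_Restr2) (auto simp: underS_def Field_def)
qed

lemma init_seg_init_seg:
  assumes r: "Well_order r" and y: "y \<in> underS r x"
  shows "init_seg (init_seg r x) y = init_seg r y"
proof -
  have tr: "trans r" and an: "antisym r" using r by (auto simp: order_on_defs)
  have *: "z \<in> underS r x" if "z \<in> underS r y" for z
    using that y transD[OF tr, of z y x] antisymD[OF an, of x y] by (auto simp: underS_def)
  have "underS (init_seg r x) y = underS r y"
    using * y by (auto simp: underS_def)
  with * show ?thesis by auto
qed

text \<open>Well-orders on a fixed type are well-founded under \<open>ordLess\<close>, and proper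
  initial segments are smaller. This gives transfinite induction along the recursion of
  \<open>S_iter\<close>, with the order itself as induction variable.\<close>

lemma Well_order_init_seg_induct [consumes 1, case_names step]:
  assumes "Well_order r"
    and step: "\<And>r. Well_order r \<Longrightarrow> (\<And>x. x \<in> Field r \<Longrightarrow> P (init_seg r x)) \<Longrightarrow> P r"
  shows "P r"
proof -
  have "Well_order r \<longrightarrow> P r"
  proof (induction r rule: wf_induct_rule[OF wf_ordLess])
    case (1 r)
    show ?case
    proof
      assume r: "Well_order r"
      show "P r"
      proof (rule step[OF r])
        fix x assume "x \<in> Field r"
        then have "(init_seg r x, r) \<in> ordLess"
          using r by (auto intro: underS_Restr_ordLess)
        then show "P (init_seg r x)"
          using 1 r by (simp add: Well_order_Restr)
      qed
    qed
  qed
  with assms(1) show ?thesis by simp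
qed

lemma Well_order_linear:
  assumes "Well_order r" "x \<in> Field r" "y \<in> Field r"
  obtains "x = y" | "x \<in> underS r y" | "y \<in> underS r x"
  using assms by (auto simp: order_on_defs total_on_def underS_def)

section \<open>Iterated sequential closures in a topological space\<close>

lemma seq_closure_mono: "F \<subseteq> G \<Longrightarrow> seq_closure T F \<subseteq> seq_closure T G"
  by (auto simp: seq_closure_def)

lemma subset_seq_closure: "F \<subseteq> topspace T \<Longrightarrow> F \<subseteq> seq_closure T F"
  by (auto simp: seq_closure_def intro!: exI[of _ "\<lambda>_. _"])

text \<open>Does not distinguish successors from limits, so that inductions need only one step.\<close>

lemma S_iter_unfold:
  assumes "Well_order r" and F: "F \<subseteq> topspace T"
  shows "S_iter T F r = F \<union> (\<Union>x\<in>Field r. seq_closure T (S_iter T F (init_seg r x)))"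
  using assms(1)
proof (induction r rule: Well_order_init_seg_induct)
  case (step r)
  let ?S = "\<lambda>x. S_iter T F (init_seg r x)"
  let ?R = "F \<union> (\<Union>x\<in>Field r. seq_closure T (?S x))"
  \<comment> \<open>Segments of a segment are segments of \<open>r\<close>, so the unfolding at each
    earlier stage can be written with stages of \<open>r\<close> itself.\<close>
  have IH: "?S x = F \<union> (\<Union>y\<in>underS r x. seq_closure T (?S y))" if "x \<in> Field r" for x
    using step(2)[OF that] step(1) by (simp add: Field_init_seg init_seg_init_seg cong: SUP_cong)
  have sub: "underS r x \<subseteq> Field r" for x
    by (auto simp: underS_def Field_def)
  have top: "?S x \<subseteq> topspace T" if "x \<in> Field r" for x
    unfolding IH[OF that] using F by (auto simp: seq_closure_def dest: limitin_topspace)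
  have mono: "?S x \<subseteq> ?S y" if "x \<in> Field r" "y \<in> Field r" "(x, y) \<in> r" for x y
  proof -
    have "trans r" "antisym r" using step(1) by (auto simp: order_on_defs)
    then have "underS r x \<subseteq> underS r y"
      using that(3) by (auto simp: underS_def dest: transD antisymD)
    then show ?thesis unfolding IH[OF that(1)] IH[OF that(2)] by auto
  qed
  consider "Field r = {}" | m where "greatest_elem r m"
    | "Field r \<noteq> {}" "\<nexists>m. greatest_elem r m" by blast
  then show ?case
  proof cases
    case 1
    then show ?thesis by (simp add: S_iter.simps[of T F r])
  next
    case (2 m)
    then have m: "m \<in> Field r" "\<And>x. x \<in> Field r \<Longrightarrow> (x, m) \<in> r"
      by (auto simp: greatest_elem_def)
    \<comment> \<open>The term of the greatest element absorbs all others: stages increase, and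
      constant sequences keep the points of \<open>F\<close>.\<close>
    have "?R \<subseteq> seq_closure T (?S m)"
    proof -
      have "F \<subseteq> seq_closure T (?S m)"
        using subset_seq_closure[OF top[OF m(1)]] IH[OF m(1)] by blast
      moreover have "seq_closure T (?S x) \<subseteq> seq_closure T (?S m)" if "x \<in> Field r" for x
        using that m by (intro seq_closure_mono mono)
      ultimately show ?thesis by blast
    qed
    moreover have "seq_closure T (?S m) \<subseteq> ?R" using m by blast
    ultimately show ?thesis unfolding S_iter_succ[OF step(1) 2] by (intro equalityI)
  next
    case 3
    \<comment> \<open>Without a greatest element, \<open>x\<close> lies strictly below some
      \<open>y\<close>, and by \<open>IH\<close> the stage at \<open>y\<close> already contains the
      sequential closure of the stage at \<open>x\<close>.\<close>
    have "seq_closure T (?S x) \<subseteq> (\<Union>y\<in>Field r. ?S y)" if x: "x \<in> Field r" for x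
    proof -
      obtain y where y: "y \<in> Field r" "(y, x) \<notin> r"
        using 3(2) x by (auto simp: greatest_elem_def)
      moreover have "(x, x) \<in> r"
        using step(1) x by (auto simp: order_on_defs dest: refl_onD)
      ultimately have "x \<in> underS r y"
        by (cases rule: Well_order_linear[OF step(1) x y(1)]) (auto simp: underS_def)
      then have "seq_closure T (?S x) \<subseteq> ?S y" using IH[OF y(1)] by blast
      then show ?thesis using y by blast
    qed
    moreover have "F \<subseteq> (\<Union>y\<in>Field r. ?S y)" using IH 3(1) by blast
    moreover have "(\<Union>y\<in>Field r. ?S y) \<subseteq> ?R" using IH sub by blast
    ultimately show ?thesis unfolding S_iter_limit[OF step(1) 3] by blast
  qed
qed

lemma S_iter_init_seg_mono:
  assumes r: "Well_order r" and F: "F \<subseteq> topspace T" and x: "x \<in> underS r y"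
  shows "S_iter T F (init_seg r x) \<subseteq> S_iter T F (init_seg r y)"
proof -
  have "trans r" "antisym r" using r by (auto simp: order_on_defs)
  then have sub: "underS r x \<subseteq> underS r y"
    using x by (auto simp: underS_def dest: transD antisymD)
  have "S_iter T F (init_seg r z) =
      F \<union> (\<Union>u\<in>underS r z. seq_closure T (S_iter T F (init_seg r u)))" for z
    using S_iter_unfold[OF Well_order_Restr[OF r, of "underS r z"] F] r
    by (simp add: Field_init_seg init_seg_init_seg cong: SUP_cong)
  from this[of x] this[of y] show ?thesis using sub by blast
qed

text \<open>Closed sets absorb limits of sequences. With the closure of \<open>F\<close> as
  \<open>K\<close> this bounds every stage; with the whole space it keeps the stages inside
  it.\<close>

lemma S_iter_subset_closedin:
  assumes "Well_order r" "F \<subseteq> K" "closedin T K"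
  shows "S_iter T F r \<subseteq> K"
  using assms(1)
proof (induction r rule: Well_order_init_seg_induct)
  case (step r)
  have "F \<subseteq> topspace T" using assms closedin_subset by blast
  have "seq_closure T (S_iter T F (init_seg r x)) \<subseteq> K" if "x \<in> Field r" for x
    using step(2)[OF that] limitin_closedin[OF _ assms(3) always_eventually]
    by (fastforce simp: seq_closure_def)
  then show ?case
    unfolding S_iter_unfold[OF step(1) \<open>F \<subseteq> topspace T\<close>] using assms(2) by blast
qed

lemma S_iter_subset_topspace:
  "Well_order r \<Longrightarrow> F \<subseteq> topspace T \<Longrightarrow> S_iter T F r \<subseteq> topspace T"
  by (rule S_iter_subset_closedin) auto

text \<open>Sequential continuity of \<open>h\<close> carries each stage into the corresponding one.
  It is demanded only for sequences whose images lie in the second space, because \<open>h\<close>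
  may map other points outside; by induction the images of stages stay inside.\<close>

lemma S_iter_image_subset:
  assumes "Well_order r" and F: "F \<subseteq> topspace T" and G: "G \<subseteq> topspace T'"
    and h: "h ` F \<subseteq> G"
    and lim: "\<And>s l. \<lbrakk>limitin T s l sequentially; \<And>n. h (s n) \<in> topspace T'\<rbrakk> \<Longrightarrow>
      limitin T' (\<lambda>n. h (s n)) (h l) sequentially"
  shows "h ` S_iter T F r \<subseteq> S_iter T' G r"
  using assms(1)
proof (induction r rule: Well_order_init_seg_induct)
  case (step r)
  have "h ` seq_closure T (S_iter T F (init_seg r x)) \<subseteq>
      seq_closure T' (S_iter T' G (init_seg r x))" if "x \<in> Field r" for x
  proof
    fix z assume "z \<in> h ` seq_closure T (S_iter T F (init_seg r x))"
    then obtain s l where s: "z = h l" "\<And>n. s n \<in> S_iter T F (init_seg r x)"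
      "limitin T s l sequentially" by (auto simp: seq_closure_def)
    have hs: "h (s n) \<in> S_iter T' G (init_seg r x)" for n
      using step(2)[OF that] s(2) by blast
    then have "h (s n) \<in> topspace T'" for n
      using S_iter_subset_topspace[OF Well_order_Restr[OF step(1)] G] by blast
    then show "z \<in> seq_closure T' (S_iter T' G (init_seg r x))"
      using hs lim[OF s(3)] s(1) by (auto simp: seq_closure_def intro!: exI[of _ "\<lambda>n. h (s n)"])
  qed
  then show ?case
    unfolding S_iter_unfold[OF step(1) F] S_iter_unfold[OF step(1) G] using h by blast
qed

lemma S_iter_mono:
  assumes "Well_order r" "F \<subseteq> G" "G \<subseteq> topspace T"
  shows "S_iter T F r \<subseteq> S_iter T G r"
  using S_iter_image_subset[of r F T G T "\<lambda>x. x"] assms by simp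

section \<open>Iteration along an ordinal sum\<close>

lemma init_seg_ord_sum_Inl: "init_seg (ord_sum r s) (Inl x) = ord_sum (init_seg r x) {}"
  by (auto simp: ord_sum_def underS_def)

lemma init_seg_ord_sum_Inr:
  assumes "Well_order s" "y \<in> Field s"
  shows "init_seg (ord_sum r s) (Inr y) = ord_sum r (init_seg s y)"
  unfolding ord_sum_def Field_init_seg[OF assms(1)]
  using assms(2) by (auto simp: underS_def intro: FieldI1 FieldI2)

text \<open>The segment below \<open>Inl x\<close> in a sum has the sum type, so a segment of
  \<open>r\<close> reappears there as a sum with the empty order. Only the underlying type
  changes.\<close>

lemma S_iter_ord_sum_empty:
  assumes "Well_order r" and F: "F \<subseteq> topspace T"
  shows "S_iter T F (ord_sum r ({} :: 'c rel)) = S_iter T F r"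
  using assms(1)
proof (induction r rule: Well_order_init_seg_induct)
  case (step r)
  have "Well_order (ord_sum r ({} :: 'c rel))"
    using step(1) by (intro Well_order_ord_sum) auto
  from S_iter_unfold[OF this F] show ?case
    unfolding S_iter_unfold[OF step(1) F] Field_ord_sum
    using step(2) by (simp add: init_seg_ord_sum_Inl cong: SUP_cong)
qed

text \<open>Induction on the second summand. In the unfolding for the sum, \<open>F\<close> and the
  terms indexed by \<open>r\<close> make up \<open>S_iter T F r\<close>, the starting set of the
  second iteration; the remaining terms match by the induction hypothesis.\<close>

lemma S_iter_ord_sum:
  assumes r: "Well_order r" and "Well_order s" and F: "F \<subseteq> topspace T"
  shows "S_iter T F (ord_sum r s) = S_iter T (S_iter T F r) s"
  using assms(2)
proof (induction s rule: Well_order_init_seg_induct)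
  case (step s)
  have "S_iter T F (ord_sum r s) = F
      \<union> (\<Union>x\<in>Field r. seq_closure T (S_iter T F (init_seg r x)))
      \<union> (\<Union>y\<in>Field s. seq_closure T (S_iter T (S_iter T F r) (init_seg s y)))"
    unfolding S_iter_unfold[OF Well_order_ord_sum[OF r step(1)] F] Field_ord_sum
    using step F r
    by (simp add: init_seg_ord_sum_Inl init_seg_ord_sum_Inr S_iter_ord_sum_empty Well_order_Restr
        Un_assoc cong: SUP_cong)
  also have "\<dots> = S_iter T (S_iter T F r) s"
    using S_iter_unfold[OF step(1) S_iter_subset_topspace[OF r F]] S_iter_unfold[OF r F] by simp
  finally show ?case .
qed

section \<open>Limits and closures in the weak* topology of the dual ball\<close>

lemma topspace_weak_star: "topspace (weak_star V) = dual V"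
  by (auto simp: weak_star_def dual_def PiE_def)

lemma topspace_weak_star_ball: "topspace (weak_star_ball V) = dual_ball V"
  by (auto simp: weak_star_ball_def topspace_weak_star dual_ball_def)

lemma limitin_weak_star:
  assumes "\<And>n. s n \<in> dual V"
  shows "limitin (weak_star V) s l sequentially \<longleftrightarrow>
    l \<in> dual V \<and> (\<forall>v\<in>carrier V. (\<lambda>n. s n v) \<longlonglongrightarrow> l v)"
proof -
  have "s n \<in> extensional (carrier V)" for n using assms[of n] by (auto simp: dual_def)
  moreover have "l \<in> extensional (carrier V)" if "l \<in> dual V"
    using that by (auto simp: dual_def)
  ultimately show ?thesis
    using assms by (auto simp: weak_star_def limitin_subtopology limitin_componentwise PiE_def)
qed

lemma limitin_weak_star_ball:
  assumes "\<And>n. s n \<in> dual_ball V"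
  shows "limitin (weak_star_ball V) s l sequentially \<longleftrightarrow>
    l \<in> dual_ball V \<and> (\<forall>v\<in>carrier V. (\<lambda>n. s n v) \<longlonglongrightarrow> l v)"
  using limitin_weak_star[of s V l] assms
  by (auto simp: weak_star_ball_def limitin_subtopology dual_ball_def)

text \<open>Convergence in a subspace forces only eventual membership, so this direction also serves
  sequences not known to lie in the ball.\<close>

lemma limitin_weak_star_ball_pointwise:
  assumes "limitin (weak_star_ball V) s l sequentially" "v \<in> carrier V"
  shows "(\<lambda>n. s n v) \<longlonglongrightarrow> l v"
  using assms
  by (auto simp: weak_star_ball_def weak_star_def limitin_subtopology limitin_componentwise)

text \<open>A basic neighbourhood constrains finitely many vectors, so a finite set \<open>A\<close>
  and one common error \<open>e\<close> suffice. The approximation arguments below use this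
  form.\<close>

lemma closure_of_weak_star_ball:
  assumes "C \<subseteq> dual_ball V"
  shows "f \<in> weak_star_ball V closure_of C \<longleftrightarrow> f \<in> dual_ball V \<and>
    (\<forall>A e. finite A \<longrightarrow> A \<subseteq> carrier V \<longrightarrow> e > 0 \<longrightarrow> (\<exists>g\<in>C. \<forall>v\<in>A. \<bar>g v - f v\<bar> < e))"
    (is "?l \<longleftrightarrow> _ \<and> ?r")
proof
  let ?P = "product_topology (\<lambda>_. euclideanreal) (carrier V)"
  assume l: ?l
  then have f: "f \<in> dual_ball V"
    by (simp add: in_closure_of topspace_weak_star_ball)
  have "\<exists>g\<in>C. \<forall>v\<in>A. \<bar>g v - f v\<bar> < e" if A: "finite A" "A \<subseteq> carrier V" "e > 0" for A e
  proof -
    let ?U = "{g \<in> dual_ball V. \<forall>v\<in>A. \<bar>g v - f v\<bar> < e}"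
    let ?B = "PiE (carrier V) (\<lambda>v. if v \<in> A then ball (f v) e else UNIV)"
    have "openin ?P ?B"
      using A by (subst openin_PiE_gen) (auto intro: finite_subset[OF _ A(1)] split: if_splits)
    moreover have "?U = ?B \<inter> dual V \<inter> dual_ball V"
      using A by (auto simp: dual_ball_def dual_def PiE_def Pi_def dist_real_def abs_minus_commute
          split: if_splits)
    ultimately have "openin (weak_star_ball V) ?U"
      unfolding weak_star_ball_def weak_star_def openin_subtopology by blast
    moreover have "f \<in> ?U" using f A by auto
    ultimately have "\<exists>g. g \<in> C \<and> g \<in> ?U" using l unfolding in_closure_of by meson
    then show ?thesis by blast
  qed
  with f show "f \<in> dual_ball V \<and> ?r" by blast
next
  let ?P = "product_topology (\<lambda>_. euclideanreal) (carrier V)"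
  assume r: "f \<in> dual_ball V \<and> ?r"
  show ?l
    unfolding in_closure_of topspace_weak_star_ball
  proof (intro conjI allI impI)
    show "f \<in> dual_ball V" using r by simp
    fix U assume U: "f \<in> U \<and> openin (weak_star_ball V) U"
    then obtain W where W: "openin ?P W" "U = W \<inter> dual V \<inter> dual_ball V"
      unfolding weak_star_ball_def weak_star_def openin_subtopology by blast
    with U obtain B where B: "finite {i \<in> carrier V. B i \<noteq> UNIV}" "\<And>i. i \<in> carrier V \<Longrightarrow> open (B i)"
      "f \<in> PiE (carrier V) B" "PiE (carrier V) B \<subseteq> W"
      unfolding openin_product_topology_alt by (auto 0 3)
    let ?A = "{i \<in> carrier V. B i \<noteq> UNIV}"
    have "\<exists>e>0. ball (f i) e \<subseteq> B i" if "i \<in> ?A" for i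
      using that B(2,3) open_contains_ball by (auto simp: PiE_def Pi_def)
    then obtain e where e: "\<And>i. i \<in> ?A \<Longrightarrow> e i > 0 \<and> ball (f i) (e i) \<subseteq> B i" by metis
    \<comment> \<open>The extra 1 keeps the minimum defined and positive when no coordinate is
      constrained.\<close>
    define d where "d = Min (insert 1 (e ` ?A))"
    have d: "d > 0" "\<And>i. i \<in> ?A \<Longrightarrow> d \<le> e i"
      using B(1) e by (auto simp: d_def Min_gr_iff)
    obtain g where g: "g \<in> C" "\<And>v. v \<in> ?A \<Longrightarrow> \<bar>g v - f v\<bar> < d"
      using r B(1) d(1) by (metis (no_types, lifting) mem_Collect_eq subsetI)
    have "g v \<in> B v" if "v \<in> carrier V" for v
    proof (cases "B v = UNIV")
      case False
      then have v: "v \<in> ?A" using that by simp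
      then have "g v \<in> ball (f v) (e v)"
        using g(2)[OF v] d(2)[OF v] by (simp add: dist_real_def abs_minus_commute)
      then show ?thesis using e[OF v] by blast
    qed simp
    moreover have gd: "g \<in> dual V" "g \<in> dual_ball V" using g assms by (auto simp: dual_ball_def)
    ultimately have "g \<in> PiE (carrier V) B" by (auto simp: dual_def PiE_def)
    then have "g \<in> W" using B(4) by (rule rev_subsetD)
    then have "g \<in> U" using gd W(2) by simp
    then show "\<exists>y. y \<in> C \<and> y \<in> U" using g(1) by blast
  qed
qed

section \<open>Dual balls of subspaces and of the whole space\<close>

lemma carrier_subspace_of [simp]: "carrier (subspace_of Y) = Y"
  by (simp add: subspace_of_def)

lemma convex_functionals_whole_space_iff:
  "convex_functionals whole_space C \<longleftrightarrow>
    (\<forall>f\<in>C. \<forall>g\<in>C. \<forall>t\<in>{0..1}. (\<lambda>v. (1 - t) * f v + t * g v) \<in> C)"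
  by (simp add: convex_functionals_def restrict_UNIV)

text \<open>A real supremum can be compared memberwise for a nonempty set that is bounded above.
  Boundedness comes from membership in the dual, nonemptiness from the witness
  \<open>z\<close>.\<close>

lemma dual_norm_le_iff:
  assumes f: "f \<in> dual V" and nonneg: "\<And>v. v \<in> carrier V \<Longrightarrow> 0 \<le> vnorm V v"
    and z: "z \<in> carrier V" "vnorm V z \<le> 1"
  shows "dual_norm V f \<le> K \<longleftrightarrow> (\<forall>v\<in>carrier V. vnorm V v \<le> 1 \<longrightarrow> \<bar>f v\<bar> \<le> K)"
proof -
  obtain L where L: "\<And>v. v \<in> carrier V \<Longrightarrow> \<bar>f v\<bar> \<le> L * vnorm V v"
    using f unfolding dual_def by blast
  have "bdd_above ((\<lambda>v. \<bar>f v\<bar>) ` {v \<in> carrier V. vnorm V v \<le> 1})"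
  proof (rule bdd_aboveI2)
    fix v assume v: "v \<in> {v \<in> carrier V. vnorm V v \<le> 1}"
    \<comment> \<open>\<open>L\<close> may be negative, so its absolute value serves as the bound on
      the unit ball.\<close>
    have "L * vnorm V v \<le> \<bar>L\<bar> * 1"
      using v nonneg by (intro mult_mono) auto
    then show "\<bar>f v\<bar> \<le> \<bar>L\<bar>" using L[of v] v by simp
  qed
  moreover have "{v \<in> carrier V. vnorm V v \<le> 1} \<noteq> {}" using z by blast
  ultimately show ?thesis
    unfolding dual_norm_def by (subst cSUP_le_iff) auto
qed

text \<open>Rescaling to norm 1 replaces the supremum in \<open>dual_norm\<close> by a pointwise
  inequality, which passes directly to restrictions and limits.\<close>

lemma dual_ball_subspace_of_iff:
  assumes "subspace Y"
  shows "f \<in> dual_ball (subspace_of Y) \<longleftrightarrow> f \<in> extensional Y \<and>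
    (\<forall>u\<in>Y. \<forall>v\<in>Y. f (u + v) = f u + f v) \<and> (\<forall>c. \<forall>v\<in>Y. f (c *\<^sub>R v) = c * f v) \<and>
    (\<forall>v\<in>Y. \<bar>f v\<bar> \<le> norm v)"
    (is "_ \<longleftrightarrow> ?ext \<and> ?add \<and> ?scale \<and> ?le")
proof -
  have dual: "f \<in> dual (subspace_of Y) \<longleftrightarrow>
      ?ext \<and> ?add \<and> ?scale \<and> (\<exists>K. \<forall>v\<in>Y. \<bar>f v\<bar> \<le> K * norm v)"
    by (simp add: dual_def subspace_of_def)
  have norm: "dual_norm (subspace_of Y) f \<le> 1 \<longleftrightarrow> (\<forall>v\<in>Y. norm v \<le> 1 \<longrightarrow> \<bar>f v\<bar> \<le> 1)"
    if "f \<in> dual (subspace_of Y)"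
    using dual_norm_le_iff[OF that, of 0 1] subspace_0[OF assms] by (simp add: subspace_of_def)
  have "?le" if sc: ?scale and le: "\<forall>v\<in>Y. norm v \<le> 1 \<longrightarrow> \<bar>f v\<bar> \<le> 1"
  proof
    fix v assume v: "v \<in> Y"
    show "\<bar>f v\<bar> \<le> norm v"
    proof (cases "v = 0")
      case True
      \<comment> \<open>Homogeneity with scalar 0 covers the vector that cannot be
        normalized.\<close>
      then show ?thesis using sc[rule_format, of v 0] v by simp
    next
      case False
      have "(1 / norm v) *\<^sub>R v \<in> Y" using assms v by (rule subspace_scale)
      then have "\<bar>f ((1 / norm v) *\<^sub>R v)\<bar> \<le> 1" using le False by simp
      then show ?thesis using sc v False by (simp add: abs_mult field_simps)
    qed
  qed
  moreover have "\<forall>v\<in>Y. norm v \<le> 1 \<longrightarrow> \<bar>f v\<bar> \<le> 1" if ?le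
    using that by (meson order_trans)
  moreover have "\<exists>K. \<forall>v\<in>Y. \<bar>f v\<bar> \<le> K * norm v" if ?le
    using that by (intro exI[of _ 1]) simp
  ultimately show ?thesis
    unfolding dual_ball_def using dual norm by blast
qed

lemma dual_ball_whole_space_iff:
  "f \<in> dual_ball whole_space \<longleftrightarrow> (\<forall>u v. f (u + v) = f u + f v) \<and>
    (\<forall>c v. f (c *\<^sub>R v) = c * f v) \<and> (\<forall>v. \<bar>f v\<bar> \<le> norm v)"
  using dual_ball_subspace_of_iff[of UNIV f] by simp

text \<open>The conditions cutting out the ball are equations and weak inequalities between finitely
  many values, hence survive pointwise limits. Weak* convergence of a sequence in the ball thus
  reduces to pointwise convergence.\<close>

lemma dual_ball_whole_space_limit:
  assumes s: "\<And>n. s n \<in> dual_ball whole_space" and lim: "\<And>v. (\<lambda>n. s n v) \<longlonglongrightarrow> l v"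
  shows "l \<in> dual_ball whole_space"
  unfolding dual_ball_whole_space_iff
proof (intro conjI allI)
  have sn: "s n (u + v) = s n u + s n v" "s n (c *\<^sub>R v) = c * s n v" "\<bar>s n v\<bar> \<le> norm v" for n u v c
    using s[of n] by (auto simp: dual_ball_whole_space_iff)
  show "l (u + v) = l u + l v" for u v
    using LIMSEQ_unique[OF lim[of "u + v"]] tendsto_add[OF lim[of u] lim[of v]] sn by simp
  show "l (c *\<^sub>R v) = c * l v" for c v
    using LIMSEQ_unique[OF lim[of "c *\<^sub>R v"]] tendsto_mult_left[OF lim[of v], of c] sn by simp
  show "\<bar>l v\<bar> \<le> norm v" for v
    using sn by (intro LIMSEQ_le_const2[OF tendsto_rabs[OF lim]]) auto
qed

section \<open>Convexity of the iterated sequential closures\<close>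

lemma convex_seq_closure:
  assumes C: "C \<subseteq> dual_ball whole_space" "convex_functionals whole_space C"
  shows "convex_functionals whole_space (seq_closure (weak_star_ball whole_space) C)"
  unfolding convex_functionals_whole_space_iff
proof (intro ballI)
  fix f g :: "'a \<Rightarrow> real" and t :: real
  assume t: "t \<in> {0..1}"
  assume "f \<in> seq_closure (weak_star_ball whole_space) C"
    and "g \<in> seq_closure (weak_star_ball whole_space) C"
  then obtain a b where a: "\<And>n. a n \<in> C" "limitin (weak_star_ball whole_space) a f sequentially"
    and b: "\<And>n. b n \<in> C" "limitin (weak_star_ball whole_space) b g sequentially"
    unfolding seq_closure_def by blast
  let ?c = "\<lambda>n v. (1 - t) * a n v + t * b n v"
  have c: "?c n \<in> C" for n
    using C(2) a(1)[of n] b(1)[of n] t by (auto simp: convex_functionals_whole_space_iff)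
  have lim: "(\<lambda>n. ?c n v) \<longlonglongrightarrow> (1 - t) * f v + t * g v" for v
    using limitin_weak_star_ball_pointwise[OF a(2), of v]
      limitin_weak_star_ball_pointwise[OF b(2), of v]
    by (auto intro!: tendsto_intros)
  have cb: "?c n \<in> dual_ball whole_space" for n using c C(1) by blast
  have "limitin (weak_star_ball whole_space) ?c (\<lambda>v. (1 - t) * f v + t * g v) sequentially"
    using dual_ball_whole_space_limit[OF cb lim] lim by (subst limitin_weak_star_ball[OF cb]) simp
  then show "(\<lambda>v. (1 - t) * f v + t * g v) \<in> seq_closure (weak_star_ball whole_space) C"
    unfolding seq_closure_def using c by (auto intro!: exI[of _ ?c])
qed

text \<open>A union of a chain of convex sets is convex, because any two of its points lie in a
  common member.\<close>

lemma convex_S_iter: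
  assumes "Well_order r" and C: "C \<subseteq> dual_ball whole_space" "convex_functionals whole_space C"
  shows "convex_functionals whole_space (S_iter (weak_star_ball whole_space) C r)"
  using assms(1)
proof (induction r rule: Well_order_init_seg_induct)
  case (step r)
  let ?T = "weak_star_ball whole_space" and ?conv = "convex_functionals whole_space"
  let ?Q = "\<lambda>x. seq_closure ?T (S_iter ?T C (init_seg r x))"
  have top: "C \<subseteq> topspace ?T" using C(1) by (simp add: topspace_weak_star_ball)
  have sub: "S_iter ?T C (init_seg r x) \<subseteq> dual_ball whole_space" for x
    using S_iter_subset_topspace[OF Well_order_Restr[OF step(1)] top]
    by (simp add: topspace_weak_star_ball)
  have conv: "?conv (?Q x)" if "x \<in> Field r" for x
    by (rule convex_seq_closure[OF sub step(2)[OF that]])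
  have CQ: "C \<subseteq> ?Q x" for x
  proof -
    have "C \<subseteq> S_iter ?T C (init_seg r x)"
      using S_iter_unfold[OF Well_order_Restr[OF step(1)] top] by blast
    also have "\<dots> \<subseteq> ?Q x"
      using sub by (intro subset_seq_closure) (simp add: topspace_weak_star_ball)
    finally show ?thesis .
  qed
  have mono: "?Q x \<subseteq> ?Q y" if "x \<in> underS r y" for x y
    using S_iter_init_seg_mono[OF step(1) top that] by (rule seq_closure_mono)
  \<comment> \<open>\<open>G\<close> is \<open>C\<close> itself when \<open>r\<close> is empty, and
    otherwise the larger of two members of the chain; \<open>CQ\<close> places points of
    \<open>C\<close> in such a member.\<close>
  have common: "\<exists>G. f \<in> G \<and> g \<in> G \<and> ?conv G \<and> G \<subseteq> C \<union> (\<Union>x\<in>Field r. ?Q x)"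
    if f: "f \<in> C \<union> (\<Union>x\<in>Field r. ?Q x)" and g: "g \<in> C \<union> (\<Union>x\<in>Field r. ?Q x)" for f g
  proof (cases "Field r = {}")
    case True
    then show ?thesis using f g C(2) by auto
  next
    case False
    then obtain x y where x: "x \<in> Field r" "f \<in> ?Q x" and y: "y \<in> Field r" "g \<in> ?Q y"
      using f g CQ by blast
    from Well_order_linear[OF step(1) x(1) y(1)]
    have "(f \<in> ?Q x \<and> g \<in> ?Q x) \<or> (f \<in> ?Q y \<and> g \<in> ?Q y)"
    proof cases
      case 1 then show ?thesis using x y by simp
    next
      case 2 then show ?thesis using mono[OF 2] x y by blast
    next
      case 3 then show ?thesis using mono[OF 3] x y by blast
    qed
    then show ?thesis using conv x(1) y(1) by blast
  qed
  show ?case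
    unfolding S_iter_unfold[OF step(1) top] convex_functionals_whole_space_iff
  proof (intro ballI)
    fix f g and t :: real
    assume f: "f \<in> C \<union> (\<Union>x\<in>Field r. ?Q x)" and g: "g \<in> C \<union> (\<Union>x\<in>Field r. ?Q x)"
      and t: "t \<in> {0..1}"
    obtain G where G: "f \<in> G" "g \<in> G" "?conv G" "G \<subseteq> C \<union> (\<Union>x\<in>Field r. ?Q x)"
      using common[OF f g] by blast
    then have "(\<lambda>v. (1 - t) * f v + t * g v) \<in> G"
      using t by (simp add: convex_functionals_whole_space_iff)
    with G(4) show "(\<lambda>v. (1 - t) * f v + t * g v) \<in> C \<union> (\<Union>x\<in>Field r. ?Q x)"
      by (rule subsetD)
  qed
qed

section \<open>Convex block subsequences\<close>

lemma convex_block_subseqE: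
  assumes "convex_block_subseq V x y"
  obtains I a where "\<And>k. finite (I k)" "\<And>k. I k \<noteq> {}" "\<And>k. Max (I k) < Min (I (Suc k))"
    "\<And>n. 0 \<le> a n" "\<And>k. sum a (I k) = 1"
    "\<And>k. y k = (\<lambda>v\<in>carrier V. \<Sum>n\<in>I k. a n * x n v)"
proof -
  obtain I a where *: "\<forall>k. finite (I k) \<and> I k \<noteq> {}" "\<forall>k. Max (I k) < Min (I (Suc k))"
    "\<forall>n. a n \<in> {0..1 :: real}" "\<forall>k. sum a (I k) = 1"
    "\<forall>k. y k = (\<lambda>v\<in>carrier V. \<Sum>n\<in>I k. a n * x n v)"
    using assms unfolding convex_block_subseq_def by blast
  show thesis
    by (rule that[of I a]) (use * in auto)
qed

text \<open>\<open>convex_functionals\<close> combines two points at a time. For finite combinations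
  the set is viewed inside the vector space of bounded linear functionals, where
  \<open>convex_sum\<close> applies.\<close>

lemma convex_block_subseq_mem:
  assumes C: "C \<subseteq> dual_ball whole_space" "convex_functionals whole_space C"
    and x: "\<And>n. x n \<in> C" and "convex_block_subseq whole_space x y"
  shows "y k \<in> C"
proof -
  obtain I a where I: "\<And>k. finite (I k)" "\<And>k. I k \<noteq> {}" "\<And>k. Max (I k) < Min (I (Suc k))"
    and a: "\<And>n. 0 \<le> a n" "\<And>k. sum a (I k) = 1"
    and y: "\<And>k. y k = (\<lambda>v\<in>carrier whole_space. \<Sum>n\<in>I k. a n * x n v)"
    by (rule convex_block_subseqE[OF assms(4)]) (rule that)
  let ?B = "{b. blinfun_apply b \<in> C}"
  have "\<exists>b. blinfun_apply b = x n" for n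
    using x[of n] C(1) dual_whole_space by (force simp: dual_ball_def)
  then obtain b where b: "\<And>n. blinfun_apply (b n) = x n" by metis
  have "convex ?B"
    using C(2)
    by (auto simp: convex_alt convex_functionals_whole_space_iff plus_blinfun.rep_eq
        scaleR_blinfun.rep_eq)
  then have "(\<Sum>n\<in>I k. a n *\<^sub>R b n) \<in> ?B"
    using I a b x by (intro convex_sum) auto
  moreover have "blinfun_apply (\<Sum>n\<in>I k. a n *\<^sub>R b n) = y k"
    by (auto simp: y b restrict_UNIV blinfun.sum_left blinfun.scaleR_left)
  ultimately show ?thesis by simp
qed

text \<open>Later blocks use only late indices, and a ball is convex, so averages of values near
  \<open>c\<close> are again near \<open>c\<close>.\<close>

lemma convex_block_subseq_limit:
  assumes "convex_block_subseq V x y" and v: "v \<in> carrier V" and lim: "(\<lambda>n. x n v) \<longlonglongrightarrow> c"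
  shows "(\<lambda>k. y k v) \<longlonglongrightarrow> c"
proof -
  obtain I a where I: "\<And>k. finite (I k)" "\<And>k. I k \<noteq> {}" "\<And>k. Max (I k) < Min (I (Suc k))"
    and a: "\<And>n. 0 \<le> a n" "\<And>k. sum a (I k) = 1"
    and y: "\<And>k. y k = (\<lambda>v\<in>carrier V. \<Sum>n\<in>I k. a n * x n v)"
    by (rule convex_block_subseqE[OF assms(1)]) (rule that)
  \<comment> \<open>Blocks are nonempty and successive, so their minima increase strictly with
    \<open>k\<close>.\<close>
  have min: "k \<le> Min (I k)" for k
  proof (induction k)
    case (Suc k)
    have "Min (I k) \<le> Max (I k)" using I(1,2) by (meson Max_ge Min_in)
    then show ?case using Suc I(3)[of k] by linarith
  qed simp
  show ?thesis
  proof (rule lim_explicit[THEN iffD2], intro allI impI)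
    fix U :: "real set" assume "open U" "c \<in> U"
    then obtain e where e: "e > 0" "ball c e \<subseteq> U" using open_contains_ball by blast
    obtain N where N: "\<And>n. n \<ge> N \<Longrightarrow> x n v \<in> ball c e"
      using lim e(1) by (auto simp: LIMSEQ_iff dist_real_def abs_minus_commute)
    have "y k v \<in> U" if k: "k \<ge> N" for k
    proof -
      have "n \<ge> N" if "n \<in> I k" for n
        using min[of k] Min_le[OF I(1) that] k by linarith
      then have "(\<Sum>n\<in>I k. a n *\<^sub>R x n v) \<in> ball c e"
        using a I(1) N by (intro convex_sum) auto
      then show ?thesis using e(2) v by (auto simp: y)
    qed
    then show "\<exists>N. \<forall>n\<ge>N. y n v \<in> U" by blast
  qed
qed

section \<open>Restriction of functionals to the subspace\<close>

lemma restrict_dual_ball: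
  assumes "subspace Y" "f \<in> dual_ball whole_space"
  shows "restrict f Y \<in> dual_ball (subspace_of Y)"
  using assms
  by (auto simp: dual_ball_subspace_of_iff dual_ball_whole_space_iff subspace_add subspace_scale)

lemma convex_restrict:
  assumes "subspace Y" "convex_functionals whole_space C"
  shows "convex_functionals (subspace_of Y) ((\<lambda>f. restrict f Y) ` C)"
  unfolding convex_functionals_def
proof (intro ballI)
  fix f g and t :: real
  assume t: "t \<in> {0..1}"
    and "f \<in> (\<lambda>f. restrict f Y) ` C" "g \<in> (\<lambda>f. restrict f Y) ` C"
  then obtain f' g' where fg: "f' \<in> C" "g' \<in> C" "f = restrict f' Y" "g = restrict g' Y" by blast
  then have "(\<lambda>v. (1 - t) * f' v + t * g' v) \<in> C"
    using assms(2) t by (auto simp: convex_functionals_whole_space_iff)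
  moreover have "(\<lambda>v\<in>Y. (1 - t) * f v + t * g v) = restrict (\<lambda>v. (1 - t) * f' v + t * g' v) Y"
    using fg by auto
  ultimately show "(\<lambda>v\<in>carrier (subspace_of Y). (1 - t) * f v + t * g v) \<in> (\<lambda>f. restrict f Y) ` C"
    by auto
qed

text \<open>Convex block compactness enters here. A sequence in the restricted stage is lifted to
  \<open>f n\<close> in the stage \<open>?S\<close>; a block subsequence converges on the whole
  space and remains in \<open>?S\<close> because every stage is convex.\<close>

lemma S_iter_restrict:
  fixes Y :: "'a::real_normed_vector set"
  assumes compact: "weak_star_convex_block_compact_dual_ball (whole_space :: 'a nspace)"
    and Y: "subspace Y" and "Well_order r"
    and C: "C \<subseteq> dual_ball whole_space" "convex_functionals whole_space C"
  shows "S_iter (weak_star_ball (subspace_of Y)) ((\<lambda>f. restrict f Y) ` C) r \<subseteq>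
    (\<lambda>f. restrict f Y) ` S_iter (weak_star_ball whole_space) C r"
  using assms(3)
proof (induction r rule: Well_order_init_seg_induct)
  case (step r)
  let ?R = "\<lambda>f. restrict f Y"
  let ?T = "weak_star_ball whole_space" and ?TY = "weak_star_ball (subspace_of Y)"
  have top: "C \<subseteq> topspace ?T" using C(1) by (simp add: topspace_weak_star_ball)
  have topY: "?R ` C \<subseteq> topspace ?TY"
    using C(1) restrict_dual_ball[OF Y] by (auto simp: topspace_weak_star_ball)
  have "seq_closure ?TY (S_iter ?TY (?R ` C) (init_seg r x)) \<subseteq>
      ?R ` seq_closure ?T (S_iter ?T C (init_seg r x))" if x: "x \<in> Field r" for x
  proof
    let ?S = "S_iter ?T C (init_seg r x)"
    have S: "?S \<subseteq> dual_ball whole_space" "convex_functionals whole_space ?S"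
      using S_iter_subset_topspace[OF Well_order_Restr[OF step(1)] top]
        convex_S_iter[OF Well_order_Restr[OF step(1)] C]
      by (auto simp: topspace_weak_star_ball)
    fix g assume "g \<in> seq_closure ?TY (S_iter ?TY (?R ` C) (init_seg r x))"
    then obtain t where t: "\<And>n. t n \<in> ?R ` ?S" "limitin ?TY t g sequentially"
      using step(2)[OF x] unfolding seq_closure_def by blast
    from t(1) have "\<exists>f. f \<in> ?S \<and> t n = ?R f" for n by blast
    then obtain f where f: "\<And>n. f n \<in> ?S" "\<And>n. t n = ?R (f n)" by metis
    have fb: "f n \<in> dual_ball whole_space" for n using f(1) S(1) by blast
    then have "f n \<in> dual whole_space" "dual_norm whole_space (f n) \<le> 1" for n
      by (auto simp: dual_ball_def)
    then obtain y l where y: "convex_block_subseq whole_space f y"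
      and l: "limitin (weak_star whole_space) y l sequentially"
      using compact unfolding weak_star_convex_block_compact_dual_ball_def by blast
    have yS: "y n \<in> ?S" for n by (rule convex_block_subseq_mem[OF S f(1) y])
    then have yb: "y n \<in> dual_ball whole_space" for n using S(1) by blast
    then have "y n \<in> dual whole_space" for n by (auto simp: dual_ball_def)
    from l limitin_weak_star[OF this] have lim: "(\<lambda>n. y n v) \<longlonglongrightarrow> l v" for v by simp
    have "limitin ?T y l sequentially"
      using dual_ball_whole_space_limit[OF yb lim] lim by (subst limitin_weak_star_ball[OF yb]) simp
    then have "l \<in> seq_closure ?T ?S" unfolding seq_closure_def using yS by blast
    \<comment> \<open>On \<open>Y\<close> the sequence \<open>f\<close> already converges to
      \<open>g\<close>, and forming blocks keeps that limit.\<close>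
    moreover have "g v = l v" if v: "v \<in> Y" for v
    proof -
      have "(\<lambda>n. f n v) \<longlonglongrightarrow> g v"
        using limitin_weak_star_ball_pointwise[OF t(2), of v] v by (simp add: f(2))
      then have "(\<lambda>n. y n v) \<longlonglongrightarrow> g v"
        by (intro convex_block_subseq_limit[OF y]) simp
      then show ?thesis using lim LIMSEQ_unique by blast
    qed
    \<comment> \<open>Extensionality turns agreement on \<open>Y\<close> into equality with the
      restriction of \<open>l\<close>.\<close>
    moreover have "g \<in> extensional Y"
      using limitin_topspace[OF t(2)] by (simp add: topspace_weak_star_ball dual_ball_subspace_of_iff[OF Y])
    ultimately show "g \<in> ?R ` seq_closure ?T ?S"
      by (intro image_eqI[of _ _ l]) (auto simp: restrict_def extensional_def)
  qed
  then show ?case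
    unfolding S_iter_unfold[OF step(1) top] S_iter_unfold[OF step(1) topY] by blast
qed

section \<open>Functionals on the quotient\<close>

text \<open>Meaningful only for \<open>f\<close> vanishing on \<open>Y\<close>.\<close>

definition quotient_functional ::
    "'a::real_normed_vector set \<Rightarrow> ('a \<Rightarrow> real) \<Rightarrow> 'a set \<Rightarrow> real" where
  "quotient_functional Y f = (\<lambda>A\<in>carrier (quotient_by Y). f (SOME x. x \<in> A))"

lemma carrier_quotient_by: "carrier (quotient_by Y) = range (\<lambda>x. x +o Y)"
  by (simp add: quotient_by_def)

text \<open>As \<open>f\<close> vanishes on \<open>Y\<close>, it is constant on each coset,
  whichever representative \<open>SOME\<close> selects.\<close>

lemma quotient_functional_apply:
  assumes Y: "subspace Y" and f: "f \<in> dual_ball whole_space" "\<And>v. v \<in> Y \<Longrightarrow> f v = 0"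
  shows "quotient_functional Y f (x +o Y) = f x"
proof -
  have "x \<in> x +o Y" using subspace_0[OF Y] by (auto simp: elt_set_plus_def)
  then have "(SOME z. z \<in> x +o Y) \<in> x +o Y" by (rule someI)
  then obtain v where "v \<in> Y" "(SOME z. z \<in> x +o Y) = x + v" by (auto simp: elt_set_plus_def)
  then show ?thesis
    using f by (auto simp: quotient_functional_def carrier_quotient_by dual_ball_whole_space_iff)
qed

text \<open>For \<open>y\<close> in \<open>Y\<close>, \<open>f x = f (x - y)\<close>. Hence
  \<open>\<bar>f x\<bar>\<close> is at most the distance from \<open>x\<close> to \<open>Y\<close>,
  which is the quotient norm of the coset.\<close>

lemma quotient_functional_dual_ball:
  assumes Y: "subspace Y" and f: "f \<in> dual_ball whole_space" "\<And>v. v \<in> Y \<Longrightarrow> f v = 0"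
  shows "quotient_functional Y f \<in> dual_ball (quotient_by Y)"
proof -
  let ?q = "quotient_functional Y f" and ?Q = "quotient_by Y"
  note q = quotient_functional_apply[OF assms] and ops = quotient_by_operations[OF Y]
  have lin: "f (u + v) = f u + f v" "f (c *\<^sub>R v) = c * f v" and le: "\<bar>f v\<bar> \<le> norm v" for u v c
    using f(1) by (auto simp: dual_ball_whole_space_iff)
  have diff: "f (x - y) = f x - f y" for x y
    using lin(1)[of "x - y" y] by simp
  have inf: "\<bar>f x\<bar> \<le> infdist x Y" for x
  proof -
    have "Y \<noteq> {}" using subspace_0[OF Y] by blast
    moreover have "\<bar>f x\<bar> \<le> dist x y" if "y \<in> Y" for y
      using le[of "x - y"] f(2)[OF that] by (simp add: diff dist_norm)
    ultimately show ?thesis by (auto simp: infdist_def intro: cINF_greatest)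
  qed
  have dual: "?q \<in> dual ?Q"
    unfolding dual_def carrier_quotient_by
  proof (intro CollectI conjI ballI allI)
    show "?q \<in> extensional (range (\<lambda>x. x +o Y))"
      by (simp add: quotient_functional_def carrier_quotient_by)
    show "?q (vadd ?Q A B) = ?q A + ?q B"
      if "A \<in> range (\<lambda>x. x +o Y)" "B \<in> range (\<lambda>x. x +o Y)" for A B
      using that by (auto simp: ops q lin)
    show "?q (vscale ?Q c A) = c * ?q A" if "A \<in> range (\<lambda>x. x +o Y)" for c A
      using that by (auto simp: ops q lin)
    show "\<exists>K. \<forall>A\<in>range (\<lambda>x. x +o Y). \<bar>?q A\<bar> \<le> K * vnorm ?Q A"
      using inf by (intro exI[of _ 1]) (auto simp: ops q)
  qed
  have "dual_norm ?Q ?q \<le> 1"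
  proof (subst dual_norm_le_iff[OF dual, of "0 +o Y"])
    show "0 \<le> vnorm ?Q A" if "A \<in> carrier ?Q" for A
      using that by (auto simp: carrier_quotient_by ops infdist_nonneg)
    show "0 +o Y \<in> carrier ?Q" unfolding carrier_quotient_by by (rule rangeI)
    show "vnorm ?Q (0 +o Y) \<le> 1" unfolding ops(3) using subspace_0[OF Y] by simp
    show "\<forall>A\<in>carrier ?Q. vnorm ?Q A \<le> 1 \<longrightarrow> \<bar>?q A\<bar> \<le> 1"
      using inf by (auto simp: carrier_quotient_by ops q intro: order_trans)
  qed
  then show ?thesis using dual by (simp add: dual_ball_def)
qed

text \<open>Two points of the ball are at distance at most 2, so halving their difference brings it
  back into the ball.\<close>

lemma half_difference_dual_ball:
  assumes "f \<in> dual_ball whole_space" "p \<in> dual_ball whole_space"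
  shows "(\<lambda>x. (f x - p x) / 2) \<in> dual_ball whole_space"
proof -
  have "\<bar>(f v - p v) / 2\<bar> \<le> norm v" for v
  proof -
    have "\<bar>f v\<bar> \<le> norm v" "\<bar>p v\<bar> \<le> norm v"
      using assms by (auto simp: dual_ball_whole_space_iff)
    then show ?thesis by (simp add: abs_le_iff field_simps)
  qed
  then show ?thesis
    using assms by (auto simp: dual_ball_whole_space_iff field_simps)
qed

section \<open>The three-space argument, through the subspace and then the quotient\<close>

theorem theorem4:
  fixes Y :: "'a::banach set" and \<gamma>1 :: "'b rel" and \<gamma>2 :: "'c rel"
  assumes "weak_star_convex_block_compact_dual_ball (whole_space :: 'a nspace)"
    and "(\<gamma>1, omega1) \<in> ordLeq" and "(\<gamma>2, omega1) \<in> ordLeq"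
    and "subspace Y" and "closed Y"
    and "property_E (subspace_of Y) \<gamma>1"
    and "property_E (quotient_by Y) \<gamma>2"
  shows "property_E (whole_space :: 'a nspace) (ord_sum \<gamma>1 \<gamma>2)"
  unfolding property_E_def
proof (intro allI impI, elim conjE)
  let ?T = "weak_star_ball (whole_space :: 'a nspace)" and ?B = "dual_ball (whole_space :: 'a nspace)"
  let ?TY = "weak_star_ball (subspace_of Y)" and ?TQ = "weak_star_ball (quotient_by Y)"
  let ?R = "\<lambda>f. restrict f Y"
  note Y = \<open>subspace Y\<close>
  have wo: "Well_order \<gamma>1" "Well_order \<gamma>2"
    using assms(2,3) ordLeq_Well_order_simp by blast+
  fix C :: "('a \<Rightarrow> real) set"
  assume C: "C \<subseteq> ?B" "convex_functionals whole_space C"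
  have top: "C \<subseteq> topspace ?T" using C(1) by (simp add: topspace_weak_star_ball)
  let ?S = "S_iter ?T C \<gamma>1"
  have SB: "?S \<subseteq> ?B"
    using S_iter_subset_topspace[OF wo(1) top] by (simp add: topspace_weak_star_ball)
  have Sconv: "convex_functionals whole_space ?S" by (rule convex_S_iter[OF wo(1) C])
  show "S_iter ?T C (ord_sum \<gamma>1 \<gamma>2) = ?T closure_of C"
  proof
    show "S_iter ?T C (ord_sum \<gamma>1 \<gamma>2) \<subseteq> ?T closure_of C"
      by (intro S_iter_subset_closedin Well_order_ord_sum wo closure_of_subset top) simp
    show "?T closure_of C \<subseteq> S_iter ?T C (ord_sum \<gamma>1 \<gamma>2)"
    proof
      fix p assume "p \<in> ?T closure_of C"
      then have p: "p \<in> ?B"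
        and near: "\<And>A e. \<lbrakk>finite A; e > 0\<rbrakk> \<Longrightarrow> \<exists>g\<in>C. \<forall>v\<in>A. \<bar>g v - p v\<bar> < e"
        by (auto simp: closure_of_weak_star_ball[OF C(1)])
      define D where "D = {f \<in> ?S. \<forall>v\<in>Y. f v = p v}"
      have DB: "D \<subseteq> ?B" using SB by (auto simp: D_def)
      have near_D: "\<exists>f\<in>D. \<forall>v\<in>A. \<bar>f v - p v\<bar> < e" if A: "finite A" "e > 0" for A e
      proof -
        \<comment> \<open>Cutting \<open>C\<close> down to \<open>CA\<close> before using the
          property of \<open>Y\<close> keeps the functional found near \<open>p\<close> on
          \<open>A\<close>. The radius is \<open>e / 2\<close> because that functional only lies in
          the closure of \<open>CA\<close>, which costs another \<open>e / 2\<close>.\<close>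
        define CA where "CA = {f \<in> C. \<forall>v\<in>A. \<bar>f v - p v\<bar> \<le> e / 2}"
        have CA: "CA \<subseteq> C" "CA \<subseteq> ?B" using C(1) by (auto simp: CA_def)
        have "convex_functionals whole_space CA"
          unfolding convex_functionals_whole_space_iff
        proof (intro ballI)
          fix f g and t :: real
          assume fg: "f \<in> CA" "g \<in> CA" and t: "t \<in> {0..1}"
          have "\<bar>(1 - t) * f v + t * g v - p v\<bar> \<le> e / 2" if "v \<in> A" for v
            using convexD_alt[OF convex_cball, of "f v" "p v" "e / 2" "g v" t] fg t that
            by (simp add: CA_def dist_real_def abs_minus_commute)
          then show "(\<lambda>v. (1 - t) * f v + t * g v) \<in> CA"
            using C(2) fg t by (auto simp: CA_def convex_functionals_whole_space_iff)
        qed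
        note convCA = this
        have RCA: "?R ` CA \<subseteq> dual_ball (subspace_of Y)"
          using CA(2) restrict_dual_ball[OF Y] by blast
        have "?R p \<in> ?TY closure_of (?R ` CA)"
          unfolding closure_of_weak_star_ball[OF RCA] carrier_subspace_of
        proof (intro conjI allI impI)
          show "?R p \<in> dual_ball (subspace_of Y)" by (rule restrict_dual_ball[OF Y p])
          \<comment> \<open>One \<open>g\<close> is chosen close to \<open>p\<close> on
            \<open>A\<close> and \<open>A'\<close> together: closeness on \<open>A\<close> puts it
            in \<open>CA\<close>, closeness on \<open>A'\<close> makes its restriction approximate
            that of \<open>p\<close>.\<close>
          fix A' and e' :: real assume A': "finite A'" "A' \<subseteq> Y" "e' > 0"
          then obtain g where g: "g \<in> C" "\<And>v. v \<in> A \<union> A' \<Longrightarrow> \<bar>g v - p v\<bar> < min (e / 2) e'"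
            using near[of "A \<union> A'" "min (e / 2) e'"] A by auto
          then have "g \<in> CA" by (auto simp: CA_def intro: less_imp_le)
          moreover have "\<forall>v\<in>A'. \<bar>?R g v - ?R p v\<bar> < e'" using g(2) A'(2) by auto
          ultimately show "\<exists>g\<in>?R ` CA. \<forall>v\<in>A'. \<bar>g v - ?R p v\<bar> < e'" by blast
        qed
        then have "?R p \<in> S_iter ?TY (?R ` CA) \<gamma>1"
          using assms(6) RCA convex_restrict[OF Y convCA] unfolding property_E_def by blast
        then obtain f where f: "f \<in> S_iter ?T CA \<gamma>1" "?R p = ?R f"
          using S_iter_restrict[OF assms(1) Y wo(1) CA(2) convCA] by blast
        have "f \<in> ?S" using S_iter_mono[OF wo(1) CA(1) top] f(1) by blast
        moreover have "f v = p v" if "v \<in> Y" for v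
          using fun_cong[OF f(2), of v] that by simp
        ultimately have "f \<in> D" by (simp add: D_def)
        moreover have "\<bar>f v - p v\<bar> < e" if "v \<in> A" for v
        proof -
          have "CA \<subseteq> topspace ?T" using CA(1) top by blast
          then have "S_iter ?T CA \<gamma>1 \<subseteq> ?T closure_of CA"
            by (intro S_iter_subset_closedin wo closure_of_subset) simp_all
          then have "f \<in> ?T closure_of CA" using f(1) by blast
          then obtain g where "g \<in> CA" "\<bar>g v - f v\<bar> < e / 2"
            using A(2) unfolding closure_of_weak_star_ball[OF CA(2)]
            by (auto dest!: spec[of _ "{v}"] spec[of _ "e / 2"])
          moreover from this have "\<bar>g v - p v\<bar> \<le> e / 2" using that by (simp add: CA_def)
          ultimately show ?thesis by linarith
        qed
        ultimately show ?thesis by blast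
      qed
      \<comment> \<open>\<open>q\<close> moves \<open>p\<close> to the origin and passes to cosets.
        \<open>lift\<close> undoes it on the functionals of the ball that agree with
        \<open>p\<close> on \<open>Y\<close>, the factor 2 cancelling the halving.\<close>
      define q where "q f = quotient_functional Y (\<lambda>x. (f x - p x) / 2)" for f
      define lift where "lift g x = p x + 2 * g (x +o Y)" for g x
      have q_apply: "q f (x +o Y) = (f x - p x) / 2"
        and q_ball: "q f \<in> dual_ball (quotient_by Y)"
        if "f \<in> ?B" "\<And>v. v \<in> Y \<Longrightarrow> f v = p v" for f x
        unfolding q_def
        using quotient_functional_apply[OF Y half_difference_dual_ball[OF that(1) p]]
          quotient_functional_dual_ball[OF Y half_difference_dual_ball[OF that(1) p]] that(2) by auto
      have qD: "q f (x +o Y) = (f x - p x) / 2" if "f \<in> D" for f x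
        using that DB by (intro q_apply) (auto simp: D_def)
      have lift_q: "lift (q f) = f" if "f \<in> ?B" "\<And>v. v \<in> Y \<Longrightarrow> f v = p v" for f
        by (rule ext) (simp add: lift_def q_apply[OF that] diff_divide_distrib)
      have ED: "q ` D \<subseteq> dual_ball (quotient_by Y)"
        using DB by (auto simp: D_def intro!: q_ball)
      have "convex_functionals (quotient_by Y) (q ` D)"
        unfolding convex_functionals_def
      proof (intro ballI)
        fix f g and t :: real
        assume t: "t \<in> {0..1}" and "f \<in> q ` D" "g \<in> q ` D"
        then obtain f' g' where fg: "f' \<in> D" "g' \<in> D" "f = q f'" "g = q g'" by blast
        let ?h = "\<lambda>v. (1 - t) * f' v + t * g' v"
        have h: "?h \<in> D"
          using fg t Sconv by (auto simp: D_def convex_functionals_whole_space_iff algebra_simps)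
        \<comment> \<open>The weights \<open>1 - t\<close> and \<open>t\<close> add up to 1, so
          exactly one copy of \<open>p\<close> is subtracted on both sides.\<close>
        have "(\<lambda>A\<in>carrier (quotient_by Y). (1 - t) * f A + t * g A) = q ?h"
        proof
          fix A
          show "(\<lambda>A\<in>carrier (quotient_by Y). (1 - t) * f A + t * g A) A = q ?h A"
          proof (cases "A \<in> carrier (quotient_by Y)")
            case True
            then obtain x where "A = x +o Y" by (auto simp: carrier_quotient_by)
            then show ?thesis
              using True fg h by (simp add: qD) (simp add: field_simps)
          next
            case False
            then show ?thesis by (simp add: q_def quotient_functional_def)
          qed
        qed
        then show "(\<lambda>A\<in>carrier (quotient_by Y). (1 - t) * f A + t * g A) \<in> q ` D" using h by simp
      qed
      \<comment> \<open>\<open>q p\<close> is the zero functional on the quotient. Finitely many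
        cosets have finitely many representatives \<open>A'\<close>, on which \<open>near_D\<close>
        approximates \<open>p\<close>.\<close>
      moreover have "q p \<in> ?TQ closure_of (q ` D)"
        unfolding closure_of_weak_star_ball[OF ED]
      proof (intro conjI allI impI)
        show "q p \<in> dual_ball (quotient_by Y)" by (rule q_ball[OF p]) simp
        fix A and e :: real assume A: "finite A" "A \<subseteq> carrier (quotient_by Y)" "e > 0"
        then obtain A' where A': "finite A'" "A = (\<lambda>x. x +o Y) ` A'"
          unfolding carrier_quotient_by by (meson finite_subset_image)
        obtain f where f: "f \<in> D" "\<And>v. v \<in> A' \<Longrightarrow> \<bar>f v - p v\<bar> < e"
          using near_D[OF A'(1) A(3)] by blast
        have "\<bar>q f a - q p a\<bar> < e" if "a \<in> A" for a
          using that A'(2) f(2) A(3) by (force simp: qD[OF f(1)] q_apply[OF p])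
        then show "\<exists>g\<in>q ` D. \<forall>v\<in>A. \<bar>g v - q p v\<bar> < e" using f(1) by blast
      qed
      ultimately have "q p \<in> S_iter ?TQ (q ` D) \<gamma>2"
        using assms(7) ED unfolding property_E_def by blast
      \<comment> \<open>For an arbitrary \<open>g\<close> in the ball of the quotient,
        \<open>lift g\<close> need not lie in the ball of the dual. It does for the stages starting
        from the image of \<open>D\<close>, so sequential continuity under this proviso is
        enough.\<close>
      moreover have "lift ` S_iter ?TQ (q ` D) \<gamma>2 \<subseteq> S_iter ?T D \<gamma>2"
      proof (rule S_iter_image_subset[OF wo(2)])
        show "q ` D \<subseteq> topspace ?TQ" "D \<subseteq> topspace ?T"
          using ED DB by (simp_all add: topspace_weak_star_ball)
        show "lift ` q ` D \<subseteq> D" using DB lift_q by (auto simp: D_def)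
        fix s l
        assume s: "limitin ?TQ s l sequentially" "\<And>n. lift (s n) \<in> topspace ?T"
        have lim: "(\<lambda>n. lift (s n) v) \<longlonglongrightarrow> lift l v" for v
          unfolding lift_def
          using limitin_weak_star_ball_pointwise[OF s(1), of "v +o Y"]
          by (intro tendsto_intros) (simp add: carrier_quotient_by)
        have ball: "lift (s n) \<in> ?B" for n using s(2) by (simp add: topspace_weak_star_ball)
        show "limitin ?T (\<lambda>n. lift (s n)) (lift l) sequentially"
          using dual_ball_whole_space_limit[OF ball lim] lim
          by (subst limitin_weak_star_ball[OF ball]) simp
      qed
      ultimately have "lift (q p) \<in> S_iter ?T D \<gamma>2" by blast
      then have "p \<in> S_iter ?T D \<gamma>2" by (simp add: lift_q[OF p])
      also have "\<dots> \<subseteq> S_iter ?T ?S \<gamma>2"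
        by (rule S_iter_mono[OF wo(2)]) (use SB in \<open>auto simp: D_def topspace_weak_star_ball\<close>)
      also have "\<dots> = S_iter ?T C (ord_sum \<gamma>1 \<gamma>2)"
        by (rule S_iter_ord_sum[OF wo top, symmetric])
      finally show "p \<in> S_iter ?T C (ord_sum \<gamma>1 \<gamma>2)" .
    qed
  qed
qed

end
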